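(* Let $f \colon \mathbb{R}^n \to \mathbb{R}$ be $C^2$. For all $\tau, r \in (0,1)$, all $\varepsilon > 0$ and (Lebesgue-)almost any initial step size $\bar\alpha > 0$, gradient descent with stabilized Armijo backtracking line-search (the algorithm described in the context, run on $f$ with parameters $\tau, r, \varepsilon, \bar\alpha$) avoids the strict saddles of $f$; that is, the set of initial points $x_0 \in \mathbb{R}^n$ for which the generated sequence $(x_t)_{t\ge 0}$ converges to a strict saddle of $f$ has Lebesgue measure zero.
   Context: A strict saddle of a $C^2$ function $f$ is a point where the gradient $\nabla f$ is zero and the Hessian $\nabla^2 f$ has at least one negative eigenvalue. Stabilized backtracking gradient descent. Inputs: $\tau, r \in (0,1)$, $\bar\alpha > 0$, $\varepsilon > 0$, $x_0 \in \mathbb{R}^n$. Set $\alpha_0 \leftarrow \bar\alpha$. For $t = 0, 1, 2, \dots$: (i) while $f(x_t) - f(x_t - \alpha_t \nabla f(x_t)) < r\, \alpha_t \|\nabla f(x_t)\|^2$, replace $\alpha_t \leftarrow \tau \alpha_t$; (ii) with the resulting value of $\alpha_t$, set $x_{t+1} \leftarrow x_t - \alpha_t \nabla f(x_t)$; (iii) if $\|\nabla f(x_{t+1})\| \ge \varepsilon$, set $\alpha_{t+1} \leftarrow \bar\alpha$; otherwise set $\alpha_{t+1} \leftarrow \alpha_t$ (the value of $\alpha_t$ that was used in (ii)). *)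

theory Defs
  imports "HOL-Analysis.Analysis" "HOL-Library.While_Combinator"
begin

text \<open>Meaningful only where \<open>f\<close> is differentiable; there the witness is unique.\<close>
definition grad :: "(real ^ 'n \<Rightarrow> real) \<Rightarrow> real ^ 'n \<Rightarrow> real ^ 'n"
  where "grad f x = (THE g. GDERIV f x :> g)"

definition hessian :: "(real ^ 'n \<Rightarrow> real) \<Rightarrow> real ^ 'n \<Rightarrow> real ^ 'n ^ 'n"
  where "hessian f x = jacobian (grad f) (at x)"

definition C2 :: "(real ^ 'n \<Rightarrow> real) \<Rightarrow> bool"
  where "C2 f \<longleftrightarrow>
    (\<forall>x. f differentiable at x) \<and>
    (\<forall>x. grad f differentiable at x) \<and>
    continuous_on UNIV (hessian f)"

definition eigenvalue :: "real ^ 'n ^ 'n \<Rightarrow> real \<Rightarrow> bool"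
  where "eigenvalue A c \<longleftrightarrow> (\<exists>v. v \<noteq> 0 \<and> A *v v = c *\<^sub>R v)"

definition strict_saddle :: "(real ^ 'n \<Rightarrow> real) \<Rightarrow> real ^ 'n \<Rightarrow> bool"
  where "strict_saddle f x \<longleftrightarrow> grad f x = 0 \<and> (\<exists>c < 0. eigenvalue (hessian f x) c)"

text \<open>
  The inner loop, started from step size \<open>a\<close> at the point \<open>x\<close>.  For differentiable \<open>f\<close>,
  \<open>0 < \<tau> < 1\<close>, \<open>r < 1\<close> and \<open>a > 0\<close> the loop terminates (immediately if \<open>grad f x = 0\<close>), so the
  unspecified value that \<open>while\<close> takes on divergence never occurs.
\<close>
definition backtrack ::
  "(real ^ 'n \<Rightarrow> real) \<Rightarrow> real \<Rightarrow> real \<Rightarrow> real ^ 'n \<Rightarrow> real \<Rightarrow> real"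
  where "backtrack f \<tau> r x a =
    while (\<lambda>\<alpha>. f x - f (x - \<alpha> *\<^sub>R grad f x) < r * \<alpha> * (norm (grad f x))\<^sup>2) (\<lambda>\<alpha>. \<tau> * \<alpha>) a"

text \<open>
  The state after \<open>t\<close> outer iterations: the iterate \<open>x\<^sub>t\<close> together with the value
  of \<open>\<alpha>\<^sub>t\<close> before the inner loop of iteration \<open>t\<close> is run.
\<close>
primrec sbgd_state ::
  "(real ^ 'n \<Rightarrow> real) \<Rightarrow> real \<Rightarrow> real \<Rightarrow> real \<Rightarrow> real \<Rightarrow> real ^ 'n \<Rightarrow> nat \<Rightarrow> (real ^ 'n) \<times> real"
  where
    "sbgd_state f \<tau> r \<epsilon> abar x0 0 = (x0, abar)"
  | "sbgd_state f \<tau> r \<epsilon> abar x0 (Suc t) =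
      (let (x, a) = sbgd_state f \<tau> r \<epsilon> abar x0 t;
           \<alpha> = backtrack f \<tau> r x a;
           x' = x - \<alpha> *\<^sub>R grad f x
       in (x', if norm (grad f x') \<ge> \<epsilon> then abar else \<alpha>))"

definition sbgd ::
  "(real ^ 'n \<Rightarrow> real) \<Rightarrow> real \<Rightarrow> real \<Rightarrow> real \<Rightarrow> real \<Rightarrow> real ^ 'n \<Rightarrow> nat \<Rightarrow> real ^ 'n"
  where "sbgd f \<tau> r \<epsilon> abar x0 t = fst (sbgd_state f \<tau> r \<epsilon> abar x0 t)"

end

theory Submission
  imports Defs
begin

text \<open>
  Along a convergent run the step size is eventually a constant \<open>\<alpha> = abar * \<tau> ^ k\<close>, because Armijo's
  condition holds uniformly near the limit for small steps.  So the tail of the run is an orbit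
  of the fixed map \<open>g x = x - \<alpha> *\<^sub>R grad f x\<close> that stays close to a strict saddle.  No stable manifold
  theorem is needed, and \<open>g\<close> need not be invertible at the saddle: the difference of two such orbits never enters
  the cone of expanded directions of the symmetric matrix \<open>L = mat 1 - \<alpha> *\<^sub>R hessian f s\<close>, since inside that cone it
  would grow geometrically.  Hence the points with trapped orbits meet every line parallel to an
  expanded eigenvector at most once and form a null set.  To pull null sets back to the initial points,
  one needs \<open>mat 1 - \<alpha> *\<^sub>R hessian f x\<close> to be invertible for almost every \<open>x\<close>, for each of the countably many
  \<open>\<alpha>\<close>; by Fubini this holds for almost every \<open>abar\<close>, as for fixed \<open>x\<close> only finitely many step sizes fail.
\<close>

section \<open>Symmetry of second derivatives\<close>

text \<open>The mean value theorem in direction \<open>u\<close> turns the mixed difference into a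
  difference of two values of \<open>G\<close>; differentiability of \<open>G\<close> at
  \<open>x\<close> then expands both to first order.\<close>

lemma second_difference_estimate:
  fixes f :: "'a::real_inner \<Rightarrow> real" and G :: "'a \<Rightarrow> 'a"
  assumes f: "\<And>y. (f has_derivative (\<lambda>h. h \<bullet> G y)) (at y)"
    and G: "(G has_derivative D) (at x)"
    and "0 < e"
  shows "\<exists>d>0. \<forall>t. 0 < t \<and> t < d \<longrightarrow>
    \<bar>f (x + t *\<^sub>R u + t *\<^sub>R v) - f (x + t *\<^sub>R u) - f (x + t *\<^sub>R v) + f x - t\<^sup>2 * (u \<bullet> D v)\<bar> \<le> e * t\<^sup>2"
proof -
  \<comment> \<open>The displacements \<open>p\<close> and \<open>q\<close> below satisfy
    \<open>norm p + norm q \<le> t * (2 * norm u + norm v)\<close>; the summand 1 makes division by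
    \<open>C\<close> safe.\<close>
  define C where "C = norm u * (2 * norm u + norm v) + 1"
  have "C > 0" unfolding C_def by (intro add_nonneg_pos) auto
  define e' where "e' = e / C"
  have "e' > 0" using \<open>0 < e\<close> \<open>C > 0\<close> by (simp add: e'_def)
  interpret D: bounded_linear D using G by (rule has_derivative_bounded_linear)
  obtain d where "d > 0" and d: "\<And>y. norm (y - x) < d \<Longrightarrow> norm (G y - G x - D (y - x)) \<le> e' * norm (y - x)"
    using G \<open>e' > 0\<close> unfolding has_derivative_at_alt by blast
  \<comment> \<open>For \<open>t < d'\<close> both \<open>p\<close> and \<open>q\<close> have norm
    below \<open>d\<close>.\<close>
  define d' where "d' = d / (norm u + norm v + 1)"
  have N: "norm u + norm v + 1 > 0" by (intro add_nonneg_pos) auto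
  have "\<bar>f (x + t *\<^sub>R u + t *\<^sub>R v) - f (x + t *\<^sub>R u) - f (x + t *\<^sub>R v) + f x - t\<^sup>2 * (u \<bullet> D v)\<bar> \<le> e * t\<^sup>2"
    if t: "0 < t" "t < d'" for t
  proof -
    define \<phi> where "\<phi> s = f (x + s *\<^sub>R u + t *\<^sub>R v) - f (x + s *\<^sub>R u)" for s
    have *: "((\<lambda>s. f (w + s *\<^sub>R u)) has_derivative (\<lambda>h. h * (u \<bullet> G (w + s *\<^sub>R u)))) (at s within S)" for w s S
    proof -
      have "((\<lambda>s. w + s *\<^sub>R u) has_derivative (\<lambda>h. h *\<^sub>R u)) (at s within S)"
        by (auto intro!: derivative_eq_intros)
      from has_derivative_compose[OF this f] show ?thesis by simp
    qed
    have "(\<phi> has_derivative (\<lambda>h. h * (u \<bullet> G (x + t *\<^sub>R v + s *\<^sub>R u)) - h * (u \<bullet> G (x + s *\<^sub>R u)))) (at s within S)" for s S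
      using has_derivative_diff[OF *[of "x + t *\<^sub>R v" s S] *[of x s S]]
      by (simp add: \<phi>_def[abs_def] algebra_simps)
    then have "\<exists>\<xi>\<in>{0<..<t}. \<phi> t - \<phi> 0 = (t - 0) * (u \<bullet> G (x + t *\<^sub>R v + \<xi> *\<^sub>R u)) - (t - 0) * (u \<bullet> G (x + \<xi> *\<^sub>R u))"
      using t by (intro mvt_simple) auto
    then obtain \<xi> where \<xi>: "0 < \<xi>" "\<xi> < t"
      and eq: "\<phi> t - \<phi> 0 = t * (u \<bullet> (G (x + t *\<^sub>R v + \<xi> *\<^sub>R u) - G (x + \<xi> *\<^sub>R u)))"
      by (auto simp: algebra_simps)
    define p where "p = t *\<^sub>R v + \<xi> *\<^sub>R u"
    define q where "q = \<xi> *\<^sub>R u"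
    have tN: "t * norm u + t * norm v + t < d"
      using t N by (simp add: d'_def field_simps)
    have q: "norm q \<le> t * norm u" using \<xi> by (auto simp: q_def intro!: mult_right_mono)
    have p: "norm p \<le> t * norm v + t * norm u"
      unfolding p_def using \<xi> t by (intro norm_triangle_le add_mono) (auto intro!: mult_right_mono)
    have "0 \<le> t * norm v" "0 \<le> t * norm u" using t by auto
    then have "norm p < d" "norm q < d" using p q tN t by linarith+
    then have "norm (G (x + p) - G x - D p) \<le> e' * norm p" "norm (G (x + q) - G x - D q) \<le> e' * norm q"
      using d[of "x + p"] d[of "x + q"] by auto
    moreover have "G (x + p) - G (x + q) - t *\<^sub>R D v = (G (x + p) - G x - D p) - (G (x + q) - G x - D q)"
      by (simp add: p_def q_def D.add D.scaleR)
    ultimately have "norm (G (x + p) - G (x + q) - t *\<^sub>R D v) \<le> e' * norm p + e' * norm q"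
      by (smt (verit) norm_triangle_ineq4)
    also have "\<dots> \<le> e' * (t * norm v + t * norm u) + e' * (t * norm u)"
      using \<open>e' > 0\<close> p q by (intro add_mono mult_left_mono) auto
    also have "\<dots> = e' * t * (2 * norm u + norm v)" by (simp add: algebra_simps)
    finally have b: "norm (G (x + p) - G (x + q) - t *\<^sub>R D v) \<le> e' * t * (2 * norm u + norm v)" .
    have "f (x + t *\<^sub>R u + t *\<^sub>R v) - f (x + t *\<^sub>R u) - f (x + t *\<^sub>R v) + f x - t\<^sup>2 * (u \<bullet> D v)
      = (\<phi> t - \<phi> 0) - t\<^sup>2 * (u \<bullet> D v)"
      by (simp add: \<phi>_def)
    also have "\<dots> = t * (u \<bullet> (G (x + p) - G (x + q) - t *\<^sub>R D v))"
      unfolding eq by (simp add: p_def q_def algebra_simps inner_diff_right power2_eq_square)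
    finally have "\<bar>f (x + t *\<^sub>R u + t *\<^sub>R v) - f (x + t *\<^sub>R u) - f (x + t *\<^sub>R v) + f x - t\<^sup>2 * (u \<bullet> D v)\<bar>
      \<le> t * (norm u * norm (G (x + p) - G (x + q) - t *\<^sub>R D v))"
      using t by (simp add: abs_mult Cauchy_Schwarz_ineq2)
    also have "\<dots> \<le> t * (norm u * (e' * t * (2 * norm u + norm v)))"
      using t b by (intro mult_left_mono) auto
    also have "\<dots> = e' * t\<^sup>2 * (C - 1)" by (simp add: C_def power2_eq_square)
    also have "\<dots> \<le> e' * t\<^sup>2 * C" using \<open>e' > 0\<close> by (intro mult_left_mono) auto
    also have "\<dots> = e * t\<^sup>2" using \<open>C > 0\<close> by (simp add: e'_def)
    finally show ?thesis .
  qed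
  moreover have "d' > 0" using \<open>d > 0\<close> N by (simp add: d'_def)
  ultimately show ?thesis by blast
qed

text \<open>The mixed second difference is unchanged when \<open>u\<close> and \<open>v\<close> are
  swapped, so its two leading coefficients \<open>u \<bullet> D v\<close> and
  \<open>v \<bullet> D u\<close> agree.\<close>

lemma second_derivative_symmetric:
  fixes f :: "'a::real_inner \<Rightarrow> real" and G :: "'a \<Rightarrow> 'a"
  assumes f: "\<And>y. (f has_derivative (\<lambda>h. h \<bullet> G y)) (at y)"
    and G: "(G has_derivative D) (at x)"
  shows "D u \<bullet> v = u \<bullet> D v"
proof -
  have "\<bar>u \<bullet> D v - v \<bullet> D u\<bar> \<le> 0 + e" if "e > 0" for e
  proof -
    have "e / 2 > 0" using that by simp
    obtain d1 where "d1 > 0" and d1: "\<And>t. 0 < t \<and> t < d1 \<Longrightarrow>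
      \<bar>f (x + t *\<^sub>R u + t *\<^sub>R v) - f (x + t *\<^sub>R u) - f (x + t *\<^sub>R v) + f x - t\<^sup>2 * (u \<bullet> D v)\<bar> \<le> e / 2 * t\<^sup>2"
      using second_difference_estimate[OF f G \<open>e / 2 > 0\<close>, of u v] by auto
    obtain d2 where "d2 > 0" and d2: "\<And>t. 0 < t \<and> t < d2 \<Longrightarrow>
      \<bar>f (x + t *\<^sub>R v + t *\<^sub>R u) - f (x + t *\<^sub>R v) - f (x + t *\<^sub>R u) + f x - t\<^sup>2 * (v \<bullet> D u)\<bar> \<le> e / 2 * t\<^sup>2"
      using second_difference_estimate[OF f G \<open>e / 2 > 0\<close>, of v u] by auto
    define t where "t = min d1 d2 / 2"
    have t: "0 < t" "t < d1" "t < d2" using \<open>d1 > 0\<close> \<open>d2 > 0\<close> by (auto simp: t_def)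
    define X where "X = f (x + t *\<^sub>R u + t *\<^sub>R v) - f (x + t *\<^sub>R u) - f (x + t *\<^sub>R v) + f x"
    have "f (x + t *\<^sub>R v + t *\<^sub>R u) - f (x + t *\<^sub>R v) - f (x + t *\<^sub>R u) + f x = X"
      by (simp add: X_def add.assoc add.commute[of "t *\<^sub>R v"])
    then have "\<bar>X - t\<^sup>2 * (u \<bullet> D v)\<bar> \<le> e / 2 * t\<^sup>2" "\<bar>X - t\<^sup>2 * (v \<bullet> D u)\<bar> \<le> e / 2 * t\<^sup>2"
      using d1[of t] d2[of t] t unfolding X_def by presburger+
    then have "\<bar>t\<^sup>2 * (u \<bullet> D v) - t\<^sup>2 * (v \<bullet> D u)\<bar> \<le> e * t\<^sup>2"
      by argo
    then have "t\<^sup>2 * \<bar>u \<bullet> D v - v \<bullet> D u\<bar> \<le> t\<^sup>2 * e"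
      by (metis abs_mult abs_power2 mult.commute right_diff_distrib)
    then show ?thesis using t by simp
  qed
  then have "\<bar>u \<bullet> D v - v \<bullet> D u\<bar> \<le> 0" by (rule field_le_epsilon)
  then show ?thesis by (simp add: inner_commute)
qed

section \<open>Orbits trapped near an expanding fixed point\<close>

text \<open>Eigenvectors of distinct eigenvalues are orthogonal, hence independent. This serves
  twice: for \<open>L \<circ> L\<close> when choosing \<open>\<sigma>\<close>, and for the Hessian
  when counting the step sizes that make the gradient step singular.\<close>

lemma finite_eigenvalues_of_symmetric:
  fixes L :: "'a::euclidean_space \<Rightarrow> 'a"
  assumes sym: "\<And>x y. L x \<bullet> y = x \<bullet> L y"
  shows "finite {c. \<exists>v. v \<noteq> 0 \<and> L v = c *\<^sub>R v}" (is "finite ?E")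
proof -
  define V where "V c = (SOME v. v \<noteq> 0 \<and> L v = c *\<^sub>R v)" for c
  have V: "V c \<noteq> 0 \<and> L (V c) = c *\<^sub>R V c" if "c \<in> ?E" for c
    using that someI_ex[of "\<lambda>v. v \<noteq> 0 \<and> L v = c *\<^sub>R v"] by (simp add: V_def)
  have orth: "V c \<bullet> V d = 0" if "c \<in> ?E" "d \<in> ?E" "c \<noteq> d" for c d
    using sym[of "V c" "V d"] V[OF that(1)] V[OF that(2)] that(3) by simp
  have "inj_on V ?E"
    using orth V by (metis (no_types, lifting) inj_onI inner_eq_zero_iff)
  moreover have "independent (V ` ?E)"
    using orth V by (intro pairwise_orthogonal_independent) (force simp: pairwise_def orthogonal_def)+
  ultimately show ?thesis
    using finite_imageD independent_imp_finite by blast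
qed

text \<open>The translates of \<open>S\<close> by \<open>v / (n + 1)\<close> are disjoint, equally large and jointly bounded.\<close>
lemma negligible_if_lines_meet_once:
  fixes S :: "'a::euclidean_space set"
  assumes "compact S" and line: "\<And>x c. x \<in> S \<Longrightarrow> x + c *\<^sub>R v \<in> S \<Longrightarrow> c = 0"
  shows "negligible S"
proof -
  define T where "T n = (+) ((1 / real (Suc n)) *\<^sub>R v) ` S" for n
  have cT: "compact (T n)" for n unfolding T_def using \<open>compact S\<close> by (rule compact_translation)
  obtain M where M: "\<And>x. x \<in> S \<Longrightarrow> norm x \<le> M"
    using compact_imp_bounded[OF \<open>compact S\<close>] by (auto simp: bounded_iff)
  have sub: "T n \<subseteq> cball 0 (norm v + M)" for n
  proof -
    have "norm ((1 / real (Suc n)) *\<^sub>R v) \<le> 1 * norm v"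
      unfolding norm_scaleR by (intro mult_right_mono) auto
    then show ?thesis using M unfolding T_def by (auto intro!: norm_triangle_le add_mono)
  qed
  have disj: "disjoint_family T"
    unfolding disjoint_family_on_def
  proof (intro ballI impI)
    fix m n :: nat assume "m \<noteq> n"
    show "T m \<inter> T n = {}"
    proof (rule ccontr)
      assume "T m \<inter> T n \<noteq> {}"
      then obtain x y where xy: "x \<in> S" "y \<in> S" "(1 / real (Suc m)) *\<^sub>R v + x = (1 / real (Suc n)) *\<^sub>R v + y"
        by (auto simp: T_def)
      then have "y = x + (1 / real (Suc m) - 1 / real (Suc n)) *\<^sub>R v"
        by (simp add: algebra_simps)
      then have "1 / real (Suc m) - 1 / real (Suc n) = 0" using line xy by blast
      then show False using \<open>m \<noteq> n\<close> by simp
    qed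
  qed
  have "measure lebesgue S * real N \<le> measure lebesgue (cball 0 (norm v + M) :: 'a set)" for N
  proof -
    have "measure lebesgue S * real N = (\<Sum>n<N. measure lebesgue (T n))"
      by (simp add: T_def measure_translation)
    also have "\<dots> = measure lebesgue (\<Union>n<N. T n)"
      using disj cT by (intro measure_UNION_AE[symmetric])
         (auto simp: disjoint_family_on_def pairwise_def lmeasurable_compact intro!: AE_I2)
    also have "\<dots> \<le> measure lebesgue (cball 0 (norm v + M) :: 'a set)"
      using sub cT by (intro measure_mono_fmeasurable) (auto intro!: sets.finite_UN fmeasurableD lmeasurable_compact)
    finally show ?thesis .
  qed
  then have "measure lebesgue S = 0"
    by (metis ex_less_of_nat_mult linorder_not_less measure_nonneg mult.commute order_le_less)
  then show ?thesis
    using \<open>compact S\<close> negligible_iff_measure lmeasurable_compact by blast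
qed

text \<open>
  By Cauchy-Schwarz, the ratio \<open>norm (L z) / norm z\<close> does not decrease under \<open>L\<close>.  Choosing \<open>\<sigma>\<^sup>2\<close> off the
  spectrum of \<open>L \<circ> L\<close> makes the invariance of the cone \<open>norm (L z) \<ge> \<sigma> * norm z\<close> strict, and
  compactness of the unit sphere then leaves room for the perturbation \<open>e\<close>.
\<close>
lemma cone_of_symmetric_expanding:
  fixes L :: "'a::euclidean_space \<Rightarrow> 'a"
  assumes L: "linear L" and sym: "\<And>x y. L x \<bullet> y = x \<bullet> L y"
    and v: "v \<noteq> 0" "L v = \<mu> *\<^sub>R v" and \<mu>: "\<bar>\<mu>\<bar> > 1"
  obtains \<sigma> \<delta> \<kappa> where "norm (L v) > \<sigma> * norm v" "\<delta> > 0" "\<kappa> > 1"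
    "\<And>z e. norm (L z) \<ge> \<sigma> * norm z \<Longrightarrow> norm e \<le> \<delta> * norm z \<Longrightarrow>
      norm (L (L z + e)) \<ge> \<sigma> * norm (L z + e) \<and> norm (L z + e) \<ge> \<kappa> * norm z"
proof -
  interpret L: linear L by fact
  have bl: "bounded_linear L" using L by (simp add: linear_conv_bounded_linear)
  have cL: "continuous_on S (\<lambda>x. L (h x))" if "continuous_on S h" for S :: "'a set" and h
    using bounded_linear.continuous_on[OF bl that] .
  define E where "E = {c. \<exists>v. v \<noteq> 0 \<and> L (L v) = c *\<^sub>R v}"
  have "finite E"
    unfolding E_def by (rule finite_eigenvalues_of_symmetric) (simp add: sym)
  \<comment> \<open>Squaring is injective on this infinite interval, so the finite set
    \<open>E\<close> must miss the square of some \<open>\<sigma>\<close> in it.\<close>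
  have "inj_on (\<lambda>c. c\<^sup>2) {1<..<\<bar>\<mu>\<bar>}" by (auto simp: inj_on_def)
  moreover have "infinite {1<..<\<bar>\<mu>\<bar>}" using \<mu> by simp
  ultimately have "infinite ((\<lambda>c. c\<^sup>2) ` {1<..<\<bar>\<mu>\<bar>})" by (simp add: finite_image_iff)
  then obtain \<sigma> where \<sigma>: "1 < \<sigma>" "\<sigma> < \<bar>\<mu>\<bar>" "\<sigma>\<^sup>2 \<notin> E"
    using \<open>finite E\<close> by (metis (no_types, lifting) finite_subset greaterThanLessThan_iff image_subset_iff)
  have strict: "norm (L (L z)) > \<sigma> * norm (L z)" if z: "norm z = 1" "norm (L z) \<ge> \<sigma>" for z
  proof (rule ccontr)
    assume "\<not> ?thesis"
    then have le: "norm (L (L z)) \<le> \<sigma> * norm (L z)" by simp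
    have sq: "(norm (L z))\<^sup>2 = L (L z) \<bullet> z" by (simp add: power2_norm_eq_inner sym inner_commute)
    also have "\<dots> \<le> norm (L (L z))" using norm_cauchy_schwarz[of "L (L z)" z] z by simp
    finally have "norm (L z) * norm (L z) \<le> \<sigma> * norm (L z)" using le by (simp add: power2_eq_square)
    then have "norm (L z) \<le> \<sigma>" using z \<sigma> by (auto simp: mult_le_cancel_right)
    then have eq: "norm (L z) = \<sigma>" using z by simp
    \<comment> \<open>If strictness fails, Cauchy-Schwarz holds with equality; expanding the square
      makes \<open>z\<close> an eigenvector of \<open>L \<circ> L\<close> for the excluded
      eigenvalue.\<close>
    have "(norm (L (L z) - \<sigma>\<^sup>2 *\<^sub>R z))\<^sup>2 = (norm (L (L z)))\<^sup>2 - 2 * \<sigma>\<^sup>2 * (L (L z) \<bullet> z) + \<sigma>\<^sup>2 * \<sigma>\<^sup>2 * (z \<bullet> z)"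
      by (simp add: power2_norm_eq_inner inner_diff inner_commute algebra_simps)
    also have "\<dots> = (norm (L (L z)))\<^sup>2 - \<sigma>\<^sup>2 * \<sigma>\<^sup>2"
      using z(1) eq sq[symmetric] by (simp add: norm_eq_1 algebra_simps)
    also have "\<dots> \<le> (\<sigma> * \<sigma>)\<^sup>2 - \<sigma>\<^sup>2 * \<sigma>\<^sup>2"
      using le unfolding eq by (intro diff_right_mono power_mono) auto
    also have "\<dots> = 0" by (simp add: power2_eq_square)
    finally have "L (L z) = \<sigma>\<^sup>2 *\<^sub>R z" by simp
    then have "\<sigma>\<^sup>2 \<in> E" using z(1) unfolding E_def by (auto intro!: exI[of _ z])
    then show False using \<sigma> by simp
  qed
  define S where "S = {z. norm z = 1 \<and> norm (L z) \<ge> \<sigma>}"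
  have "S = sphere 0 1 \<inter> {z. \<sigma> \<le> norm (L z)}" by (auto simp: S_def)
  moreover have "closed {z. \<sigma> \<le> norm (L z)}"
    by (intro closed_Collect_le continuous_intros cL)
  ultimately have "compact S" by (simp add: compact_Int_closed)
  have Lv: "norm (L v) > \<sigma> * norm v" using v \<sigma> by simp
  then have "(1 / norm v) *\<^sub>R v \<in> S" using v \<sigma> by (simp add: S_def L.scaleR)
  then have "S \<noteq> {}" by blast
  have "continuous_on S (\<lambda>z. norm (L (L z)) - \<sigma> * norm (L z))"
    by (intro continuous_intros cL)
  then obtain z0 where z0: "z0 \<in> S" "\<And>z. z \<in> S \<Longrightarrow>
      norm (L (L z0)) - \<sigma> * norm (L z0) \<le> norm (L (L z)) - \<sigma> * norm (L z)"
    using continuous_attains_inf[OF \<open>compact S\<close> \<open>S \<noteq> {}\<close>] by blast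
  \<comment> \<open>By homogeneity, this minimum over \<open>S\<close> yields the gap
    \<open>\<eta> * norm z\<close> for every \<open>z\<close> in the cone.\<close>
  define \<eta> where "\<eta> = norm (L (L z0)) - \<sigma> * norm (L z0)"
  have "\<eta> > 0" using strict[of z0] z0(1) by (simp add: \<eta>_def S_def)
  obtain B where "B > 0" and B: "\<And>x. norm (L x) \<le> B * norm x"
    using bounded_linear.pos_bounded[OF bl] by (auto simp: mult.commute)
  \<comment> \<open>The first bound lets the gap \<open>\<eta>\<close> absorb the perturbation, so
    the cone stays invariant; the second leaves the growth factor
    \<open>(\<sigma> + 1) / 2\<close>.\<close>
  define \<delta> where "\<delta> = min (\<eta> / (B + \<sigma>)) ((\<sigma> - 1) / 2)"
  have "\<delta> > 0" using \<open>\<eta> > 0\<close> \<open>B > 0\<close> \<sigma> by (simp add: \<delta>_def)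
  have \<delta>1: "\<delta> * (B + \<sigma>) \<le> \<eta>"
    using \<open>B > 0\<close> \<sigma> by (simp add: \<delta>_def pos_le_divide_eq[symmetric])
  have \<delta>2: "\<delta> \<le> (\<sigma> - 1) / 2" unfolding \<delta>_def by (rule min.cobounded2)
  show thesis
  proof (rule that[of \<sigma> \<delta> "(\<sigma> + 1) / 2"])
    fix z e :: 'a assume z: "norm (L z) \<ge> \<sigma> * norm z" and e: "norm e \<le> \<delta> * norm z"
    show "norm (L (L z + e)) \<ge> \<sigma> * norm (L z + e) \<and> norm (L z + e) \<ge> (\<sigma> + 1) / 2 * norm z"
    proof (cases "z = 0")
      case True
      then show ?thesis using e by (simp add: L.zero)
    next
      case False
      have "(1 / norm z) *\<^sub>R z \<in> S" using False z by (simp add: S_def L.scaleR field_simps)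
      from z0(2)[OF this] have "\<eta> * norm z \<le> norm (L (L z)) - \<sigma> * norm (L z)"
        using False by (simp add: \<eta>_def[symmetric] L.scaleR field_simps)
      moreover have "norm (L (L z + e)) \<ge> norm (L (L z)) - norm (L e)"
        by (simp add: L.add) (metis add_diff_cancel norm_triangle_ineq2 norm_minus_cancel diff_minus_eq_add)
      moreover have "norm (L e) \<le> B * (\<delta> * norm z)"
        using B[of e] e \<open>B > 0\<close> by (meson mult_left_mono less_imp_le order_trans)
      moreover have "\<sigma> * norm (L z + e) \<le> \<sigma> * (norm (L z) + \<delta> * norm z)"
        using e \<sigma> by (intro mult_left_mono norm_triangle_le) auto
      moreover have "\<delta> * (B + \<sigma>) * norm z \<le> \<eta> * norm z" using \<delta>1 by (intro mult_right_mono) auto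
      ultimately have 1: "norm (L (L z + e)) \<ge> \<sigma> * norm (L z + e)" by (simp add: algebra_simps)
      have "norm (L z + e) \<ge> norm (L z) - norm e"
        by (metis diff_minus_eq_add norm_minus_cancel norm_triangle_ineq2)
      moreover have "\<delta> * norm z \<le> (\<sigma> - 1) / 2 * norm z" using \<delta>2 by (intro mult_right_mono) auto
      ultimately show ?thesis using 1 z e by (simp add: field_simps)
    qed
  qed (use Lv \<open>\<delta> > 0\<close> \<sigma> in auto)
qed

text \<open>The set of trapped points is compact and meets each line in direction \<open>v\<close>
  at most once: two trapped points on such a line would have orbits that separate geometrically
  inside a bounded ball.\<close>

lemma negligible_orbits_near_expanding_point:
  fixes g :: "'a::euclidean_space \<Rightarrow> 'a"
  assumes g: "\<And>x. (g has_derivative g' x) (at x)"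
    and cont: "\<And>e. e > 0 \<Longrightarrow> \<exists>d>0. \<forall>x\<in>cball s d. onorm (\<lambda>h. g' x h - g' s h) \<le> e"
    and sym: "\<And>x y. g' s x \<bullet> y = x \<bullet> g' s y"
    and v: "v \<noteq> 0" "g' s v = \<mu> *\<^sub>R v" and \<mu>: "\<bar>\<mu>\<bar> > 1"
  shows "\<exists>\<rho>>0. negligible {x. \<forall>t. (g ^^ t) x \<in> cball s \<rho>}"
proof -
  define L where "L = g' s"
  have "linear L" unfolding L_def using g has_derivative_linear by blast
  then interpret L: linear L .
  obtain \<sigma> \<delta> \<kappa> where Lv: "norm (L v) > \<sigma> * norm v" and "\<delta> > 0" and "\<kappa> > 1"
    and cone: "\<And>z e. norm (L z) \<ge> \<sigma> * norm z \<Longrightarrow> norm e \<le> \<delta> * norm z \<Longrightarrow>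
      norm (L (L z + e)) \<ge> \<sigma> * norm (L z + e) \<and> norm (L z + e) \<ge> \<kappa> * norm z"
    using cone_of_symmetric_expanding[OF \<open>linear L\<close>] sym v \<mu> unfolding L_def by metis
  obtain \<rho> where "\<rho> > 0" and \<rho>: "\<And>x. x \<in> cball s \<rho> \<Longrightarrow> onorm (\<lambda>h. g' x h - L h) \<le> \<delta>"
    using cont[OF \<open>\<delta> > 0\<close>] unfolding L_def by auto
  \<comment> \<open>Mean value inequality on the convex ball: the difference of two trapped orbits
    evolves by \<open>L\<close> up to an error that the cone tolerates.\<close>
  have lin: "norm (g x - g y - L (x - y)) \<le> \<delta> * norm (x - y)"
    if "x \<in> cball s \<rho>" "y \<in> cball s \<rho>" for x y
  proof -
    have "norm (g x - g y - g' s (x - y)) \<le> norm (x - y) * \<delta>"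
    proof (rule differentiable_bound_linearization[where f' = g' and S = "cball s \<rho>"])
      show "y + t *\<^sub>R (x - y) \<in> cball s \<rho>" if "t \<in> {0..1}" for t
      proof -
        have "y + t *\<^sub>R (x - y) = (1 - t) *\<^sub>R y + t *\<^sub>R x" by (simp add: algebra_simps)
        then show ?thesis
          using convexD_alt[OF convex_cball \<open>y \<in> cball s \<rho>\<close> \<open>x \<in> cball s \<rho>\<close>, of t] that by auto
      qed
      show "(g has_derivative g' x) (at x within cball s \<rho>)" if "x \<in> cball s \<rho>" for x
        using g has_derivative_at_withinI by blast
      show "onorm (g' x - g' s) \<le> \<delta>" if "x \<in> cball s \<rho>" for x
        using \<rho>[OF that] by (simp add: L_def fun_diff_def)
    qed (use \<open>\<rho> > 0\<close> in auto)
    then show ?thesis by (simp add: L_def mult.commute)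
  qed
  define W where "W = {x. \<forall>t. (g ^^ t) x \<in> cball s \<rho>}"
  have cg: "continuous_on UNIV g"
    by (rule continuous_at_imp_continuous_on) (use g has_derivative_continuous in blast)
  have ct: "continuous_on UNIV (g ^^ t)" for t
    by (induction t) (auto intro: continuous_on_compose2[OF cg] continuous_on_id simp: comp_def id_def)
  have "W = (\<Inter>t. (g ^^ t) -` cball s \<rho>)" by (auto simp: W_def)
  then have "closed W" using ct by (auto intro!: closed_vimage)
  moreover have "W \<subseteq> cball s \<rho>" by (auto simp: W_def dest: spec[of _ 0])
  ultimately have "compact W" using bounded_subset[OF bounded_cball] by (auto simp: compact_eq_bounded_closed)
  have "negligible W"
  proof (rule negligible_if_lines_meet_once[OF \<open>compact W\<close>, of v])
    fix x c assume x: "x \<in> W" and y: "x + c *\<^sub>R v \<in> W"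
    define z where "z t = (g ^^ t) (x + c *\<^sub>R v) - (g ^^ t) x" for t
    have ball: "(g ^^ t) (x + c *\<^sub>R v) \<in> cball s \<rho>" "(g ^^ t) x \<in> cball s \<rho>" for t
      using x y by (auto simp: W_def)
    have zS: "norm (z (Suc t) - L (z t)) \<le> \<delta> * norm (z t)" for t
      using lin[OF ball(1) ball(2), of t t] by (simp add: z_def)
    \<comment> \<open>Cone membership and growth are proved together, as the former yields the
      latter at the next step. The start is in the cone because \<open>z 0\<close> is a multiple of
      \<open>v\<close>.\<close>
    have "norm (L (z t)) \<ge> \<sigma> * norm (z t) \<and> norm (z t) \<ge> \<kappa> ^ t * norm (z 0)" for t
    proof (induction t)
      case 0
      have "\<bar>c\<bar> * (\<sigma> * norm v) \<le> \<bar>c\<bar> * norm (L v)" using Lv by (intro mult_left_mono) auto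
      then show ?case by (simp add: z_def L.scaleR mult.left_commute)
    next
      case (Suc t)
      have eq: "L (z t) + (z (Suc t) - L (z t)) = z (Suc t)" by simp
      from cone[of "z t", OF _ zS[of t]] Suc
      have *: "\<sigma> * norm (z (Suc t)) \<le> norm (L (z (Suc t)))" "\<kappa> * norm (z t) \<le> norm (z (Suc t))"
        unfolding eq by auto
      have "\<kappa> * (\<kappa> ^ t * norm (z 0)) \<le> \<kappa> * norm (z t)"
        using Suc \<open>\<kappa> > 1\<close> by (intro mult_left_mono) auto
      then show ?case using * by simp
    qed
    then have grow: "\<kappa> ^ t * norm (z 0) \<le> norm (z t)" for t by blast
    have bound: "norm (z t) \<le> 2 * \<rho>" for t
      using ball[of t] unfolding z_def mem_cball by norm
    show "c = 0"
    proof (rule ccontr)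
      assume "c \<noteq> 0"
      then have "norm (z 0) > 0" using v by (simp add: z_def)
      obtain t where "2 * \<rho> / norm (z 0) < \<kappa> ^ t"
        using real_arch_pow[OF \<open>\<kappa> > 1\<close>] by blast
      then have "2 * \<rho> < \<kappa> ^ t * norm (z 0)"
        using \<open>norm (z 0) > 0\<close> by (simp add: field_simps)
      then show False using grow[of t] bound[of t] by simp
    qed
  qed
  then show ?thesis using \<open>\<rho> > 0\<close> unfolding W_def by blast
qed

section \<open>The gradient step\<close>

lemma ball_onorm_matrix_diff_le:
  fixes M :: "'a::metric_space \<Rightarrow> real ^ 'n ^ 'n"
  assumes "continuous_on UNIV M" "e > 0"
  shows "\<exists>d>0. \<forall>x\<in>cball s d. onorm (\<lambda>h. M x *v h - M s *v h) \<le> e"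
proof -
  \<comment> \<open>An entrywise bound on a square matrix costs this factor in the operator
    norm.\<close>
  define c where "c = real CARD('n) * real CARD('n)"
  have "c > 0" by (simp add: c_def)
  obtain d where "d > 0" and d: "\<And>x. dist x s < d \<Longrightarrow> dist (M x) (M s) < e / c"
    using assms \<open>c > 0\<close> unfolding continuous_on_iff by (metis UNIV_I divide_pos_pos)
  have "onorm (\<lambda>h. M x *v h - M s *v h) \<le> e" if "x \<in> cball s (d / 2)" for x
  proof -
    have "norm (M x - M s) < e / c"
      using d[of x] that \<open>d > 0\<close> by (auto simp: dist_norm dist_commute norm_minus_commute)
    then have "\<bar>(M x - M s) $ i $ j\<bar> \<le> e / c" for i j
      using component_le_norm_cart[of "(M x - M s) $ i" j]
        Finite_Cartesian_Product.norm_nth_le[of "M x - M s" i] by linarith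
    from onorm_le_matrix_component[OF this] \<open>c > 0\<close>
    have "onorm ((*v) (M x - M s)) \<le> e" by (simp add: c_def)
    moreover have "(*v) (M x - M s) = (\<lambda>h. M x *v h - M s *v h)"
      by (simp add: fun_eq_iff matrix_vector_mult_diff_rdistrib)
    ultimately show ?thesis by simp
  qed
  then show ?thesis using \<open>d > 0\<close> by (intro exI[of _ "d / 2"]) auto
qed

lemma det_nonzero_iff_inj:
  fixes A :: "real ^ 'n ^ 'n"
  shows "det A \<noteq> 0 \<longleftrightarrow> inj ((*v) A)"
  by (simp add: invertible_det_nz[symmetric] invertible_left_inverse matrix_left_invertible_injective)

text \<open>The adjoint represents the derivative by a vector; uniqueness of derivatives then shows
  that the description in \<open>grad\<close> denotes this vector.\<close>

lemma C2_has_derivative: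
  assumes "C2 f"
  shows "(f has_derivative (\<lambda>h. h \<bullet> grad f x)) (at x)"
proof -
  have "f differentiable at x" using assms by (simp add: C2_def)
  then obtain f' where f': "(f has_derivative f') (at x)" by (auto simp: differentiable_def)
  define g where "g = adjoint f' 1"
  have "linear f'" using f' has_derivative_linear by blast
  then have "f' = (\<lambda>h. h \<bullet> g)" unfolding g_def by (simp add: adjoint_works fun_eq_iff)
  then have "GDERIV f x :> g" using f' by (simp add: gderiv_def)
  moreover have "g' = g" if "GDERIV f x :> g'" for g'
  proof -
    have "(\<lambda>h. h \<bullet> g') = (\<lambda>h. h \<bullet> g)"
      using that \<open>GDERIV f x :> g\<close> unfolding gderiv_def by (rule has_derivative_unique)
    then show ?thesis by (metis vector_eq_ldot)
  qed
  ultimately have "GDERIV f x :> grad f x" unfolding grad_def by (rule theI)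
  then show ?thesis by (simp add: gderiv_def)
qed

lemma C2_grad_has_derivative:
  assumes "C2 f"
  shows "(grad f has_derivative (\<lambda>h. hessian f x *v h)) (at x)"
  using assms by (simp add: C2_def hessian_def jacobian_works)

lemma C2_hessian_symmetric:
  assumes "C2 f"
  shows "(hessian f x *v u) \<bullet> v = u \<bullet> (hessian f x *v v)"
  using second_derivative_symmetric[OF C2_has_derivative C2_grad_has_derivative] assms by blast

lemma C2_continuous_grad:
  assumes "C2 f"
  shows "continuous_on UNIV (grad f)"
  using assms C2_grad_has_derivative has_derivative_continuous
  by (metis continuous_at_imp_continuous_on)

section \<open>Null sets under gradient steps of fixed size\<close>

definition gd_step :: "(real ^ 'n \<Rightarrow> real) \<Rightarrow> real \<Rightarrow> real ^ 'n \<Rightarrow> real ^ 'n"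
  where "gd_step f \<alpha> x = x - \<alpha> *\<^sub>R grad f x"

lemma gd_step_has_derivative:
  assumes "C2 f"
  shows "(gd_step f \<alpha> has_derivative (\<lambda>h. (mat 1 - \<alpha> *\<^sub>R hessian f x) *v h)) (at x)"
  unfolding gd_step_def[abs_def] matrix_vector_mult_diff_rdistrib
  by (auto intro!: derivative_eq_intros C2_grad_has_derivative assms simp: scaleR_matrix_vector_assoc)

text \<open>Where the determinant is nonzero the derivative is injective, and there preimages of
  null sets are null; the remaining points form a null set by assumption.\<close>

lemma negligible_gd_step_vimage:
  assumes "C2 f" and ae: "AE x in lebesgue. det (mat 1 - \<alpha> *\<^sub>R hessian f x) \<noteq> 0"
    and N: "negligible N"
  shows "negligible (gd_step f \<alpha> -` N)"
proof -
  let ?U = "{x. det (mat 1 - \<alpha> *\<^sub>R hessian f x) \<noteq> 0}"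
  have "negligible {x \<in> ?U. gd_step f \<alpha> x \<in> N}"
  proof (rule negligible_differentiable_vimage[OF N])
    show "inj (\<lambda>h. (mat 1 - \<alpha> *\<^sub>R hessian f x) *v h)" if "x \<in> ?U" for x
      using that by (simp add: det_nonzero_iff_inj)
    show "(gd_step f \<alpha> has_derivative (\<lambda>h. (mat 1 - \<alpha> *\<^sub>R hessian f x) *v h)) (at x within ?U)" for x
      by (rule has_derivative_at_withinI) (rule gd_step_has_derivative[OF \<open>C2 f\<close>])
  qed
  moreover have "negligible (- ?U)"
  proof -
    obtain Z where "\<And>x. x \<in> space lebesgue - Z \<Longrightarrow> det (mat 1 - \<alpha> *\<^sub>R hessian f x) \<noteq> 0"
      and Z: "Z \<in> null_sets lebesgue"
      using ae by (rule AE_E3) (rule that)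
    then have "- ?U \<subseteq> Z" by auto
    with Z show ?thesis using negligible_iff_null_sets negligible_subset by blast
  qed
  ultimately have "negligible ({x \<in> ?U. gd_step f \<alpha> x \<in> N} \<union> - ?U)" by (rule negligible_Un)
  then show ?thesis by (rule negligible_subset) auto
qed

text \<open>For fixed \<open>x\<close> and \<open>k\<close>, failure forces
  \<open>1 / (a * \<tau> ^ k)\<close> to be an eigenvalue of the symmetric Hessian, which leaves
  finitely many \<open>a\<close>. Fubini then exchanges the roles of \<open>a\<close> and
  \<open>x\<close>.\<close>

lemma AE_gd_step_nonsingular:
  assumes "C2 f" and "0 < \<tau>"
  shows "AE a in lebesgue. \<forall>k. AE x in lebesgue. det (mat 1 - (a * \<tau> ^ k) *\<^sub>R hessian f x) \<noteq> 0"
proof -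
  have cH: "continuous_on UNIV (hessian f)" using \<open>C2 f\<close> by (simp add: C2_def)
  have "AE a in lborel. AE x in lborel. det (mat 1 - (a * \<tau> ^ k) *\<^sub>R hessian f x) \<noteq> 0" for k
  proof -
    let ?P = "\<lambda>x a. det (mat 1 - (a * \<tau> ^ k) *\<^sub>R hessian f x) \<noteq> 0"
    have "finite {a. \<not> ?P x a}" for x
    proof -
      let ?E = "{c. \<exists>v. v \<noteq> 0 \<and> hessian f x *v v = c *\<^sub>R v}"
      have fE: "finite ?E" by (rule finite_eigenvalues_of_symmetric) (rule C2_hessian_symmetric[OF \<open>C2 f\<close>])
      have sub: "a \<in> (\<lambda>c. 1 / (c * \<tau> ^ k)) ` ?E" if "\<not> ?P x a" for a
      proof -
        from that have "\<not> inj ((*v) (mat 1 - (a * \<tau> ^ k) *\<^sub>R hessian f x))"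
          by (simp add: det_nonzero_iff_inj)
        then obtain v where v: "v \<noteq> 0" "(mat 1 - (a * \<tau> ^ k) *\<^sub>R hessian f x) *v v = 0"
          using linear_injective_0[OF matrix_vector_mul_linear] by blast
        then have eq: "v = (a * \<tau> ^ k) *\<^sub>R (hessian f x *v v)"
          by (simp add: matrix_vector_mult_diff_rdistrib scaleR_matrix_vector_assoc)
        then have nz: "a * \<tau> ^ k \<noteq> 0" using v(1) by force
        then have "hessian f x *v v = (1 / (a * \<tau> ^ k)) *\<^sub>R v"
          by (metis eq divide_self_if scaleR_one scaleR_scaleR times_divide_eq_left mult_1)
        then have "1 / (a * \<tau> ^ k) \<in> ?E" using v(1) by blast
        moreover have "a = 1 / (1 / (a * \<tau> ^ k) * \<tau> ^ k)" using nz by simp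
        ultimately show ?thesis by blast
      qed
      show ?thesis by (rule finite_surj[OF fE]) (rule subsetI, drule CollectD, rule sub)
    qed
    then have "AE a in lborel. ?P x a" for x
      by (intro AE_I'[of "{a. \<not> ?P x a}"] finite_imp_null_set_lborel) auto
    then have "AE x in lborel. AE a in lborel. ?P x a" by simp
    \<comment> \<open>Fubini needs joint measurability: the determinant is a polynomial in matrix
      entries that depend continuously on the pair.\<close>
    moreover have "open {p. ?P (fst p) (snd p)}"
      unfolding det_def
      by (intro open_Collect_neq continuous_intros continuous_on_compose2[OF cH]) auto
    then have "{p \<in> space (lborel \<Otimes>\<^sub>M lborel). ?P (fst p) (snd p)} \<in> sets (lborel \<Otimes>\<^sub>M lborel)"
      unfolding lborel_prod by simp
    ultimately show ?thesis using lborel_pair.AE_commute[of ?P] by blast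
  qed
  then have "AE a in lborel. \<forall>k. AE x in lborel. det (mat 1 - (a * \<tau> ^ k) *\<^sub>R hessian f x) \<noteq> 0"
    by (simp add: AE_all_countable)
  \<comment> \<open>Fubini was applied to Borel measures; the outer and then the inner statement
    pass to the completion.\<close>
  then have "AE a in lebesgue. \<forall>k. AE x in lborel. det (mat 1 - (a * \<tau> ^ k) *\<^sub>R hessian f x) \<noteq> 0"
    by (rule AE_completion)
  then show ?thesis by eventually_elim (auto intro: AE_completion)
qed

text \<open>A negative Hessian eigenvalue \<open>c\<close> becomes the eigenvalue
  \<open>1 - \<alpha> * c > 1\<close> of the derivative of the gradient step.\<close>

lemma negligible_orbits_near_strict_saddle:
  assumes "C2 f" and "strict_saddle f s" and "\<alpha> > 0"
  shows "\<exists>\<rho>>0. negligible {x. \<forall>t. (gd_step f \<alpha> ^^ t) x \<in> cball s \<rho>}"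
proof -
  obtain c v where "c < 0" and v: "v \<noteq> 0" "hessian f s *v v = c *\<^sub>R v"
    using assms(2) by (auto simp: strict_saddle_def eigenvalue_def)
  show ?thesis
  proof (rule negligible_orbits_near_expanding_point[OF gd_step_has_derivative[OF \<open>C2 f\<close>]])
    show "\<exists>d>0. \<forall>x\<in>cball s d. onorm (\<lambda>h. (mat 1 - \<alpha> *\<^sub>R hessian f x) *v h - (mat 1 - \<alpha> *\<^sub>R hessian f s) *v h) \<le> e"
      if "e > 0" for e
      using \<open>C2 f\<close> that by (intro ball_onorm_matrix_diff_le continuous_intros) (auto simp: C2_def)
    show "((mat 1 - \<alpha> *\<^sub>R hessian f s) *v x) \<bullet> y = x \<bullet> ((mat 1 - \<alpha> *\<^sub>R hessian f s) *v y)" for x y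
      using C2_hessian_symmetric[OF \<open>C2 f\<close>, of s x y]
      by (simp add: matrix_vector_mult_diff_rdistrib inner_diff scaleR_matrix_vector_assoc[symmetric])
    show "(mat 1 - \<alpha> *\<^sub>R hessian f s) *v v = (1 - \<alpha> * c) *\<^sub>R v"
      using v by (simp add: matrix_vector_mult_diff_rdistrib scaleR_matrix_vector_assoc[symmetric] algebra_simps)
    have "\<alpha> * c < 0" using \<open>\<alpha> > 0\<close> \<open>c < 0\<close> by (rule mult_pos_neg)
    then show "\<bar>1 - \<alpha> * c\<bar> > 1" by simp
  qed (rule v)
qed

section \<open>Backtracking\<close>

text \<open>The negation of the loop guard in \<open>backtrack\<close>, that is, the test that
  accepts a step size.\<close>

definition armijo :: "(real ^ 'n \<Rightarrow> real) \<Rightarrow> real \<Rightarrow> real ^ 'n \<Rightarrow> real \<Rightarrow> bool"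
  where "armijo f r x \<alpha> \<longleftrightarrow> r * \<alpha> * (norm (grad f x))\<^sup>2 \<le> f x - f (x - \<alpha> *\<^sub>R grad f x)"

text \<open>Near \<open>s\<close> the gradient is Lipschitz with some constant \<open>B\<close>, so
  a short step decreases \<open>f\<close> by at least \<open>\<alpha> * (1 - \<alpha> * B)\<close>
  times the squared gradient norm. Uniformity in \<open>x\<close> is what later bounds the step
  sizes of all late iterates at once.\<close>

lemma locally_uniform_armijo:
  fixes f :: "real ^ 'n \<Rightarrow> real"
  assumes "C2 f" and "r < 1"
  shows "\<exists>\<rho>>0. \<exists>a0>0. \<forall>x\<in>ball s \<rho>. \<forall>\<alpha>. 0 < \<alpha> \<and> \<alpha> \<le> a0 \<longrightarrow> armijo f r x \<alpha>"
proof -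
  let ?G = "grad f" and ?H = "hessian f"
  have cH: "continuous_on UNIV ?H" using \<open>C2 f\<close> by (simp add: C2_def)
  obtain d where "d > 0" and d: "\<And>x. x \<in> cball s d \<Longrightarrow> onorm (\<lambda>h. ?H x *v h - ?H s *v h) \<le> 1"
    using ball_onorm_matrix_diff_le[OF cH zero_less_one, of s] by blast
  define B where "B = 1 + onorm ((*v) (?H s))"
  have "B > 0" unfolding B_def by (intro add_pos_nonneg onorm_pos_le matrix_vector_mul_bounded_linear) auto
  have B: "onorm ((*v) (?H x)) \<le> B" if "x \<in> cball s d" for x
  proof -
    have "onorm (\<lambda>h. (?H x *v h - ?H s *v h) + ?H s *v h) \<le> onorm (\<lambda>h. ?H x *v h - ?H s *v h) + onorm ((*v) (?H s))"
      by (intro onorm_triangle bounded_linear_sub matrix_vector_mul_bounded_linear)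
    then show ?thesis using d[OF that] by (simp add: B_def)
  qed
  have lip: "norm (?G x - ?G y) \<le> B * norm (x - y)" if "x \<in> cball s d" "y \<in> cball s d" for x y
    using that B
    by (intro differentiable_bound[of "cball s d" _ "\<lambda>x. (*v) (?H x)"])
      (auto intro: has_derivative_at_withinI C2_grad_has_derivative[OF \<open>C2 f\<close>])
  define M where "M = norm (?G s) + B * d + 1"
  have "M > 0" unfolding M_def using \<open>B > 0\<close> \<open>d > 0\<close> by (intro add_nonneg_pos add_nonneg_nonneg) auto
  have M: "norm (?G x) \<le> M" if "x \<in> cball s d" for x
  proof -
    have "norm (?G x - ?G s) \<le> B * norm (x - s)" using lip that \<open>d > 0\<close> by auto
    also have "\<dots> \<le> B * d" using that \<open>B > 0\<close> by (auto simp: dist_norm norm_minus_commute)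
    finally show ?thesis using norm_triangle_ineq2[of "?G x" "?G s"] by (simp add: M_def)
  qed
  \<comment> \<open>The first bound keeps a step from the half-radius ball inside
    \<open>cball s d\<close>; the second gives \<open>1 - \<alpha> * B \<ge> r\<close>.\<close>
  define a0 where "a0 = min (d / (2 * M)) ((1 - r) / B)"
  have "a0 > 0" using \<open>d > 0\<close> \<open>M > 0\<close> \<open>B > 0\<close> \<open>r < 1\<close> by (simp add: a0_def)
  have "armijo f r x \<alpha>" if x: "x \<in> ball s (d / 2)" and \<alpha>: "0 < \<alpha>" "\<alpha> \<le> a0" for x \<alpha>
  proof -
    define g where "g = ?G x"
    have xd: "x \<in> cball s d" using x \<open>d > 0\<close> by auto
    have "\<alpha> \<le> d / (2 * M)" "\<alpha> \<le> (1 - r) / B" using \<alpha> by (auto simp: a0_def)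
    then have aM: "\<alpha> * M \<le> d / 2" and aB: "\<alpha> * B \<le> 1 - r"
      using \<open>M > 0\<close> \<open>B > 0\<close> by (simp_all add: field_simps)
    have *: "((\<lambda>u. f (x - u *\<^sub>R g)) has_derivative (\<lambda>h. - h * (g \<bullet> ?G (x - u *\<^sub>R g)))) (at u within S)" for u S
    proof -
      have "((\<lambda>u. x - u *\<^sub>R g) has_derivative (\<lambda>h. - h *\<^sub>R g)) (at u within S)"
        by (auto intro!: derivative_eq_intros)
      from has_derivative_compose[OF this C2_has_derivative[OF \<open>C2 f\<close>]] show ?thesis by simp
    qed
    obtain \<xi> where \<xi>: "0 < \<xi>" "\<xi> < \<alpha>"
      and eq: "f (x - \<alpha> *\<^sub>R g) - f (x - 0 *\<^sub>R g) = - (\<alpha> - 0) * (g \<bullet> ?G (x - \<xi> *\<^sub>R g))"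
      using mvt_simple[OF \<alpha>(1) *] by auto
    have "norm (\<xi> *\<^sub>R g) \<le> \<alpha> * M"
      unfolding norm_scaleR using \<xi> M[OF xd] by (intro mult_mono) (auto simp: g_def)
    then have "x - \<xi> *\<^sub>R g \<in> cball s d"
      using x aM norm_triangle_ineq4[of "x - s" "\<xi> *\<^sub>R g"]
      by (simp add: dist_norm norm_minus_commute algebra_simps)
    then have "norm (?G x - ?G (x - \<xi> *\<^sub>R g)) \<le> B * norm (\<xi> *\<^sub>R g)"
      using lip[OF xd] by force
    also have "\<dots> \<le> B * (\<alpha> * norm g)"
      unfolding norm_scaleR using \<xi> \<open>B > 0\<close> by (intro mult_left_mono mult_right_mono) auto
    finally have 1: "norm (g - ?G (x - \<xi> *\<^sub>R g)) \<le> B * (\<alpha> * norm g)" by (simp add: g_def)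
    have "g \<bullet> (g - ?G (x - \<xi> *\<^sub>R g)) \<le> norm g * (B * (\<alpha> * norm g))"
      using norm_cauchy_schwarz[of g "g - ?G (x - \<xi> *\<^sub>R g)"] 1 by (meson mult_left_mono norm_ge_zero order_trans)
    also have "\<dots> = \<alpha> * B * (norm g)\<^sup>2" by (simp add: power2_eq_square)
    also have "\<dots> \<le> (1 - r) * (norm g)\<^sup>2" using aB by (intro mult_right_mono) auto
    finally have "r * (norm g)\<^sup>2 \<le> g \<bullet> ?G (x - \<xi> *\<^sub>R g)"
      by (simp add: inner_diff_right power2_norm_eq_inner algebra_simps)
    then have "\<alpha> * (r * (norm g)\<^sup>2) \<le> \<alpha> * (g \<bullet> ?G (x - \<xi> *\<^sub>R g))" using \<alpha> by (intro mult_left_mono) auto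
    then show ?thesis using eq by (simp add: armijo_def g_def algebra_simps)
  qed
  then show ?thesis using \<open>d > 0\<close> \<open>a0 > 0\<close> by (intro exI[of _ "d / 2"]) auto
qed

text \<open>The loop terminates because Armijo's condition holds at \<open>x\<close> for small
  steps. The second conclusion, that an acceptable step size is kept, is what later freezes the
  exponent.\<close>

lemma backtrack_eq_power:
  fixes f :: "real ^ 'n \<Rightarrow> real"
  assumes "C2 f" and "0 < \<tau>" "\<tau> < 1" and "r < 1" and "a > 0"
  obtains j where "backtrack f \<tau> r x a = a * \<tau> ^ j" and "armijo f r x a \<Longrightarrow> j = 0"
proof -
  let ?b = "\<lambda>\<alpha>. f x - f (x - \<alpha> *\<^sub>R grad f x) < r * \<alpha> * (norm (grad f x))\<^sup>2"
  have b: "?b \<alpha> \<longleftrightarrow> \<not> armijo f r x \<alpha>" for \<alpha> by (auto simp: armijo_def)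
  have pow: "((\<lambda>\<alpha>. \<tau> * \<alpha>) ^^ k) a = a * \<tau> ^ k" for k by (induction k) auto
  obtain \<rho> a0 where "\<rho> > 0" "a0 > 0" and arm: "\<And>y \<alpha>. y \<in> ball x \<rho> \<Longrightarrow> 0 < \<alpha> \<Longrightarrow> \<alpha> \<le> a0 \<Longrightarrow> armijo f r y \<alpha>"
    using locally_uniform_armijo[OF \<open>C2 f\<close> \<open>r < 1\<close>, of x] by blast
  obtain k where "\<tau> ^ k < a0 / a"
    using real_arch_pow_inv[of "a0 / a" \<tau>] \<open>a0 > 0\<close> \<open>a > 0\<close> \<open>\<tau> < 1\<close> by auto
  then have "a * \<tau> ^ k \<le> a0" using \<open>a > 0\<close> by (simp add: field_simps)
  then have "armijo f r x (a * \<tau> ^ k)" using arm \<open>\<rho> > 0\<close> \<open>a > 0\<close> \<open>0 < \<tau>\<close> by auto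
  then obtain t where t: "while_option ?b (\<lambda>\<alpha>. \<tau> * \<alpha>) a = Some t"
    using pow b unfolding while_option_def by (metis (no_types, lifting))
  then obtain j where j: "t = a * \<tau> ^ j" using while_option_stop2[OF t] pow by auto
  have bt: "backtrack f \<tau> r x a = t" by (simp add: backtrack_def while_def t)
  show thesis
  proof (cases "armijo f r x a")
    case True
    then have "while_option ?b (\<lambda>\<alpha>. \<tau> * \<alpha>) a = Some a"
      by (subst while_option_unfold) (simp add: b)
    then show thesis using that[of 0] t bt by simp
  next
    case False
    then show thesis using that[of j] j bt by simp
  qed
qed

text \<open>Either some late value reaches \<open>K\<close> and the sequence is frozen from there
  on, or the late values are bounded by \<open>K\<close> and a monotone sequence stays at its
  maximum.\<close>

lemma eventually_constant_power:
  fixes k :: "nat \<Rightarrow> nat"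
  assumes mono: "\<And>t. t \<ge> T \<Longrightarrow> k t \<le> k (Suc t)"
    and stop: "\<And>t. t \<ge> T \<Longrightarrow> K \<le> k t \<Longrightarrow> k (Suc t) = k t"
  shows "\<exists>T'\<ge>T. \<forall>t\<ge>T'. k t = k T'"
proof (cases "\<exists>t\<ge>T. K \<le> k t")
  case True
  then obtain t0 where t0: "t0 \<ge> T" "K \<le> k t0" by blast
  have "k t = k t0" if "t \<ge> t0" for t
    using that by (induction t rule: dec_induct) (use t0 stop in auto)
  then show ?thesis using t0 by blast
next
  case False
  then have "\<forall>y. (\<exists>t\<ge>T. k t = y) \<longrightarrow> y \<le> K" by (metis nat_le_linear)
  then obtain y where y: "\<exists>t\<ge>T. k t = y" "\<And>z. (\<exists>t\<ge>T. k t = z) \<Longrightarrow> z \<le> y"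
    using Nat.ex_has_greatest_nat[of "\<lambda>y. \<exists>t\<ge>T. k t = y" "k T" K] by auto
  then obtain t0 where t0: "t0 \<ge> T" "k t0 = y" by blast
  have "k t = y" if "t \<ge> t0" for t
    using that
  proof (induction t rule: dec_induct)
    case (step t)
    then have "t \<ge> T" "Suc t \<ge> T" using t0 by auto
    then show ?case using mono[of t] y(2)[of "k (Suc t)"] step by (metis le_antisym)
  qed (rule t0)
  then show ?thesis using t0 by auto
qed

section \<open>Runs of the algorithm for fixed parameters\<close>

context
  fixes f :: "real ^ 'n \<Rightarrow> real" and \<tau> r \<epsilon> abar :: real
  assumes C2: "C2 f" and \<tau>: "0 < \<tau>" "\<tau> < 1" and r: "r < 1" and abar: "abar > 0"
begin

text \<open>A reset returns to exponent 0 and backtracking adds to the exponent, so all step sizes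
  lie in one countable family.\<close>

lemma sbgd_state_step_size:
  "\<exists>k. snd (sbgd_state f \<tau> r \<epsilon> abar x0 t) = abar * \<tau> ^ k"
proof (induction t)
  case 0
  show ?case by (auto intro: exI[of _ 0])
next
  case (Suc t)
  obtain x a where st: "sbgd_state f \<tau> r \<epsilon> abar x0 t = (x, a)" by force
  with Suc obtain k where k: "a = abar * \<tau> ^ k" by auto
  then have "a > 0" using abar \<tau> by simp
  obtain j where "backtrack f \<tau> r x a = a * \<tau> ^ j"
    using backtrack_eq_power[OF C2 \<tau> r \<open>a > 0\<close>] by metis
  then have "backtrack f \<tau> r x a = abar * \<tau> ^ (k + j)" by (simp add: k power_add)
  then have "snd (sbgd_state f \<tau> r \<epsilon> abar x0 (Suc t)) \<in> {abar * \<tau> ^ 0, abar * \<tau> ^ (k + j)}"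
    by (simp add: st Let_def)
  then show ?case by blast
qed

lemma sbgd_Suc:
  "\<exists>k. sbgd f \<tau> r \<epsilon> abar x0 (Suc t) = gd_step f (abar * \<tau> ^ k) (sbgd f \<tau> r \<epsilon> abar x0 t)"
proof -
  obtain x a where st: "sbgd_state f \<tau> r \<epsilon> abar x0 t = (x, a)" by force
  with sbgd_state_step_size[of x0 t] obtain k where k: "a = abar * \<tau> ^ k" by auto
  then have "a > 0" using abar \<tau> by simp
  obtain j where "backtrack f \<tau> r x a = a * \<tau> ^ j"
    using backtrack_eq_power[OF C2 \<tau> r \<open>a > 0\<close>] by metis
  then have "backtrack f \<tau> r x a = abar * \<tau> ^ (k + j)" by (simp add: k power_add)
  then show ?thesis by (auto simp: sbgd_def st Let_def gd_step_def)
qed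

text \<open>Peeling off the last step replaces \<open>N\<close> by a countable union of its
  preimages under fixed gradient steps; hence the induction generalizes over
  \<open>N\<close>.\<close>

lemma negligible_sbgd_vimage:
  assumes ae: "\<And>k. AE x in lebesgue. det (mat 1 - (abar * \<tau> ^ k) *\<^sub>R hessian f x) \<noteq> 0"
    and "negligible N"
  shows "negligible {x0. sbgd f \<tau> r \<epsilon> abar x0 t \<in> N}"
  using \<open>negligible N\<close>
proof (induction t arbitrary: N)
  case 0
  then show ?case by (simp add: sbgd_def)
next
  case (Suc t)
  have "negligible (\<Union>k. {x0. sbgd f \<tau> r \<epsilon> abar x0 t \<in> gd_step f (abar * \<tau> ^ k) -` N})"
    by (intro negligible_Union_nat Suc.IH negligible_gd_step_vimage C2 ae Suc.prems)
  moreover have "{x0. sbgd f \<tau> r \<epsilon> abar x0 (Suc t) \<in> N}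
      \<subseteq> (\<Union>k. {x0. sbgd f \<tau> r \<epsilon> abar x0 t \<in> gd_step f (abar * \<tau> ^ k) -` N})"
    using sbgd_Suc by auto metis
  ultimately show ?case by (rule negligible_subset)
qed

text \<open>The gradient tends to 0, so eventually it stays below \<open>\<epsilon>\<close> and no
  reset occurs. From then on the exponent never decreases, and it cannot grow once the step size is
  at most \<open>a0\<close>.\<close>

lemma sbgd_eventually_constant_step:
  assumes lim: "sbgd f \<tau> r \<epsilon> abar x0 \<longlonglongrightarrow> s" and "grad f s = 0" and "\<epsilon> > 0"
  shows "\<exists>T k. \<forall>t\<ge>T. sbgd f \<tau> r \<epsilon> abar x0 (Suc t) = gd_step f (abar * \<tau> ^ k) (sbgd f \<tau> r \<epsilon> abar x0 t)"
proof -
  let ?x = "sbgd f \<tau> r \<epsilon> abar x0" and ?a = "\<lambda>t. snd (sbgd_state f \<tau> r \<epsilon> abar x0 t)"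
  obtain \<rho> a0 where "\<rho> > 0" "a0 > 0" and arm: "\<And>y \<alpha>. y \<in> ball s \<rho> \<Longrightarrow> 0 < \<alpha> \<Longrightarrow> \<alpha> \<le> a0 \<Longrightarrow> armijo f r y \<alpha>"
    using locally_uniform_armijo[OF C2 r, of s] by blast
  obtain k where k: "\<And>t. ?a t = abar * \<tau> ^ k t" using sbgd_state_step_size by metis
  then have apos: "?a t > 0" for t using abar \<tau> by simp
  obtain K where "\<tau> ^ K < a0 / abar"
    using real_arch_pow_inv[of "a0 / abar" \<tau>] \<open>a0 > 0\<close> abar \<tau> by auto
  then have K: "abar * \<tau> ^ K \<le> a0" using abar by (simp add: field_simps)
  have "isCont (grad f) s" using C2_continuous_grad[OF C2] by (simp add: continuous_on_eq_continuous_at)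
  then have "(\<lambda>t. grad f (?x t)) \<longlonglongrightarrow> 0" using lim \<open>grad f s = 0\<close> isCont_tendsto_compose by metis
  then have "\<forall>\<^sub>F t in sequentially. norm (grad f (?x t)) < \<epsilon>"
    using \<open>\<epsilon> > 0\<close> by (metis tendsto_norm_zero order_tendstoD(2))
  moreover have "\<forall>\<^sub>F t in sequentially. ?x t \<in> ball s \<rho>"
    using tendstoD[OF lim \<open>\<rho> > 0\<close>] by eventually_elim (simp add: dist_commute)
  ultimately have "\<forall>\<^sub>F t in sequentially. norm (grad f (?x t)) < \<epsilon> \<and> ?x t \<in> ball s \<rho>"
    by (rule eventually_conj)
  then obtain T where T: "\<And>t. t \<ge> T \<Longrightarrow> norm (grad f (?x t)) < \<epsilon>" "\<And>t. t \<ge> T \<Longrightarrow> ?x t \<in> ball s \<rho>"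
    by (auto simp: eventually_sequentially)
  \<comment> \<open>Without a reset, the state after iteration \<open>t\<close> stores exactly the
    step size that iteration \<open>t\<close> used; hence the index \<open>Suc t\<close>.\<close>
  have step: "?a (Suc t) = backtrack f \<tau> r (?x t) (?a t) \<and> ?x (Suc t) = gd_step f (?a (Suc t)) (?x t)"
    if "t \<ge> T" for t
  proof -
    have "norm (grad f (?x (Suc t))) < \<epsilon>" using T(1) that by simp
    then show ?thesis
      by (cases "sbgd_state f \<tau> r \<epsilon> abar x0 t") (auto simp: sbgd_def Let_def gd_step_def)
  qed
  have eq: "abar * \<tau> ^ i = abar * \<tau> ^ j \<longleftrightarrow> i = j" for i j
    using abar \<tau> power_inject_exp'[of \<tau> i j] by auto
  have ev: "\<exists>j. k (Suc t) = k t + j \<and> (K \<le> k t \<longrightarrow> j = 0)" if "t \<ge> T" for t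
  proof -
    obtain j where j: "backtrack f \<tau> r (?x t) (?a t) = ?a t * \<tau> ^ j" "armijo f r (?x t) (?a t) \<Longrightarrow> j = 0"
      using backtrack_eq_power[OF C2 \<tau> r apos] by metis
    have "?a (Suc t) = ?a t * \<tau> ^ j" using step[OF that] j(1) by metis
    then have "abar * \<tau> ^ k (Suc t) = abar * \<tau> ^ (k t + j)"
      unfolding k by (simp add: power_add)
    moreover have "j = 0" if "K \<le> k t"
    proof -
      have "abar * \<tau> ^ k t \<le> abar * \<tau> ^ K"
        using abar \<tau> that by (intro mult_left_mono power_decreasing) auto
      then have "?a t \<le> a0" using K k by simp
      then show ?thesis using j(2) arm[OF T(2)[OF \<open>t \<ge> T\<close>] apos] by blast
    qed
    ultimately show ?thesis using eq by blast
  qed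
  have "\<exists>T'\<ge>T. \<forall>t\<ge>T'. k t = k T'"
    by (rule eventually_constant_power[of T k K]) (use ev in force)+
  then obtain T' where T': "T' \<ge> T" "\<And>t. t \<ge> T' \<Longrightarrow> k t = k T'" by blast
  have "?x (Suc t) = gd_step f (abar * \<tau> ^ k T') (?x t)" if "t \<ge> T'" for t
    using step[of t] T'(1) T'(2)[of "Suc t"] that k[of "Suc t"] by auto
  then show ?thesis by blast
qed

text \<open>There may be uncountably many saddles, each with its own trapping radius. For each
  exponent, Lindelof reduces the trapping neighbourhoods to countably many.\<close>

lemma sbgd_avoids_strict_saddles:
  assumes ae: "\<And>k. AE x in lebesgue. det (mat 1 - (abar * \<tau> ^ k) *\<^sub>R hessian f x) \<noteq> 0"
    and "\<epsilon> > 0"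
  shows "negligible {x0. \<exists>s. strict_saddle f s \<and> sbgd f \<tau> r \<epsilon> abar x0 \<longlonglongrightarrow> s}"
proof -
  define N where "N k V = {x. \<forall>t. (gd_step f (abar * \<tau> ^ k) ^^ t) x \<in> V}" for k V
  define \<U> where "\<U> k = {V. open V \<and> negligible (N k V)}" for k
  have "\<exists>\<V>. \<V> \<subseteq> \<U> k \<and> countable \<V> \<and> \<Union>\<V> = \<Union>(\<U> k)" for k
    by (rule Lindelof[of "\<U> k"]) (auto simp: \<U>_def)
  then obtain \<V> where \<V>: "\<And>k. \<V> k \<subseteq> \<U> k" "\<And>k. countable (\<V> k)" "\<And>k. \<Union>(\<V> k) = \<Union>(\<U> k)"
    by metis
  have N: "negligible (N k V)" if "V \<in> \<V> k" for k V
    using \<V>(1) that unfolding \<U>_def by blast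
  \<comment> \<open>A bad run is recorded by three countable choices: the final exponent, a time
    after which the tail is trapped, and the trapping set.\<close>
  define Z where "Z = (\<Union>k. \<Union>T. \<Union>V\<in>\<V> k. {x0. sbgd f \<tau> r \<epsilon> abar x0 T \<in> N k V})"
  have "negligible (\<Union>V\<in>\<V> k. {x0. sbgd f \<tau> r \<epsilon> abar x0 T \<in> N k V})" for k T
    using \<V>(2) N negligible_sbgd_vimage[OF ae]
    by (intro negligible_countable_Union countable_image) auto
  then have "negligible Z" unfolding Z_def by (intro negligible_Union_nat)
  moreover have "x0 \<in> Z" if s: "strict_saddle f s" and lim: "sbgd f \<tau> r \<epsilon> abar x0 \<longlonglongrightarrow> s" for x0 s
  proof -
    let ?x = "sbgd f \<tau> r \<epsilon> abar x0"
    obtain T k where step: "\<And>t. t \<ge> T \<Longrightarrow> ?x (Suc t) = gd_step f (abar * \<tau> ^ k) (?x t)"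
      using sbgd_eventually_constant_step[OF lim _ \<open>\<epsilon> > 0\<close>] s by (auto simp: strict_saddle_def)
    obtain \<rho> where "\<rho> > 0" and neg: "negligible {x. \<forall>t. (gd_step f (abar * \<tau> ^ k) ^^ t) x \<in> cball s \<rho>}"
      using negligible_orbits_near_strict_saddle[OF C2 s, of "abar * \<tau> ^ k"] abar \<tau> by auto
    \<comment> \<open>\<open>N k\<close> is monotone in its set argument, so the closed ball may be
      replaced by the open ball that the covering requires.\<close>
    have "negligible (N k (ball s \<rho>))"
      by (rule negligible_subset[OF neg]) (auto simp: N_def less_imp_le)
    then have "ball s \<rho> \<in> \<U> k" by (simp add: \<U>_def)
    then have "s \<in> \<Union>(\<V> k)" unfolding \<V>(3) using \<open>\<rho> > 0\<close> by (meson UnionI centre_in_ball)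
    then obtain V where V: "V \<in> \<V> k" "s \<in> V" by blast
    then have "open V" using \<V>(1) unfolding \<U>_def by blast
    then obtain T1 where T1: "\<And>t. t \<ge> T1 \<Longrightarrow> ?x t \<in> V"
      using topological_tendstoD[OF lim _ V(2)] by (auto simp: eventually_sequentially)
    define T2 where "T2 = max T T1"
    have "(gd_step f (abar * \<tau> ^ k) ^^ t) (?x T2) = ?x (T2 + t)" for t
      by (induction t) (simp_all add: step T2_def)
    then have "?x T2 \<in> N k V" using T1 by (simp add: N_def T2_def)
    then show ?thesis using V(1) unfolding Z_def by blast
  qed
  ultimately show ?thesis by (rule_tac negligible_subset) auto
qed

end

theorem theorem1p2:
  fixes f :: "real ^ 'n \<Rightarrow> real" and \<tau> r \<epsilon> :: real
  assumes "C2 f"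
    and "0 < \<tau>" and "\<tau> < 1"
    and "0 < r" and "r < 1"
    and "\<epsilon> > 0"
  shows "AE abar in lebesgue. abar > 0 \<longrightarrow>
    {x0. \<exists>s. strict_saddle f s \<and> sbgd f \<tau> r \<epsilon> abar x0 \<longlonglongrightarrow> s} \<in> null_sets lebesgue"
  using AE_gd_step_nonsingular[OF \<open>C2 f\<close> \<open>0 < \<tau>\<close>]
proof eventually_elim
  case (elim abar)
  then show ?case
    using sbgd_avoids_strict_saddles[OF assms(1-3,5) _ _ assms(6)] by (simp add: negligible_iff_null_sets)
qed

end
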